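(* There is an algorithm which, given words $u_1,\dots,u_n,v_1,\dots,v_n\in\Sigma^*$ of length at most $\ell$ and $k\in\mathbb{N}$, decides whether there is an $\mathbf{LTL}$ formula of size at most $k$ separating $u_1,\dots,u_n$ from $v_1,\dots,v_n$. The algorithm runs in time and space $O(e(k)\cdot n\cdot \ell)$ for some function $e(k)$ exponential in $k$, i.e. $e(k)=2^{O(k)}$.
   Context: Alphabet $\Sigma=\{a,b\}$. Words are nonempty and indexed from position 1; $w(i)$ is the letter at position $i$ of $w=w(1)\cdots w(\ell)$. $\mathbf{LTL}$ formulas are built from atomic formulas $c\in\Sigma$, the binary connectives $\wedge,\vee$ and the unary operators $\mathbf{X},\mathbf{F},\mathbf{G}$. Semantics over a finite word $w$ of length $\ell$ at position $i\in[1,\ell]$: $w,i\models c$ iff $w(i)=c$; the connectives $\wedge,\vee$ are interpreted as usual; $w,i\models\mathbf{X}\phi$ iff $i<\ell$ and $w,i+1\models\phi$; $w,i\models\mathbf{F}\phi$ iff $w,i'\models\phi$ for some $i'\in[i,\ell]$; $w,i\models\mathbf{G}\phi$ iff $w,i'\models\phi$ for all $i'\in[i,\ell]$. Write $w\models\phi$ iff $w,1\models\phi$. The size of a formula is the number of nodes of its syntax tree. A formula $\phi$ separates $u_1,\dots,u_n$ from $v_1,\dots,v_m$ if $u_j\models\phi$ for all $j$ and $v_j\not\models\phi$ for all $j$. *)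

theory Defs
  imports Main
begin

datatype letter = La | Lb

datatype ltl =
    Atom letter
  | And ltl ltl
  | Or ltl ltl
  | Next ltl
  | Fin ltl
  | Glob ltl

text \<open>Positions are 0-based here: position i corresponds to position i+1 of the paper.\<close>
fun sat :: "letter list \<Rightarrow> nat \<Rightarrow> ltl \<Rightarrow> bool" where
  "sat w i (Atom c) = (w ! i = c)"
| "sat w i (And p q) = (sat w i p \<and> sat w i q)"
| "sat w i (Or p q) = (sat w i p \<or> sat w i q)"
| "sat w i (Next p) = (Suc i < length w \<and> sat w (Suc i) p)"
| "sat w i (Fin p) = (\<exists>j. i \<le> j \<and> j < length w \<and> sat w j p)"
| "sat w i (Glob p) = (\<forall>j. i \<le> j \<and> j < length w \<longrightarrow> sat w j p)"

definition models :: "letter list \<Rightarrow> ltl \<Rightarrow> bool" where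
  "models w p = sat w 0 p"

fun fsize :: "ltl \<Rightarrow> nat" where
  "fsize (Atom c) = 1"
| "fsize (And p q) = Suc (fsize p + fsize q)"
| "fsize (Or p q) = Suc (fsize p + fsize q)"
| "fsize (Next p) = Suc (fsize p)"
| "fsize (Fin p) = Suc (fsize p)"
| "fsize (Glob p) = Suc (fsize p)"

definition separates :: "ltl \<Rightarrow> letter list list \<Rightarrow> letter list list \<Rightarrow> bool" where
  "separates p us vs = ((\<forall>u\<in>set us. models u p) \<and> (\<forall>v\<in>set vs. \<not> models v p))"

text \<open>A machine is (K, Q, S, delta): K tapes (two-way infinite, indexed by int),
  states {0..<Q} (0 = start, 1 = accept, 2 = reject; 1 and 2 are halting),
  tape alphabet {0..<S} (0 = blank), and a transition function
  delta q (symbols read) = (new state, symbols written, head moves in {-1,0,1}).\<close>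

type_synonym machine = "nat \<times> nat \<times> nat \<times> (nat \<Rightarrow> nat list \<Rightarrow> nat \<times> nat list \<times> int list)"

type_synonym config = "nat \<times> (int \<Rightarrow> nat) list \<times> int list"

definition wf_machine :: "machine \<Rightarrow> bool" where
  "wf_machine M = (case M of (K, Q, S, \<delta>) \<Rightarrow>
     K \<ge> 1 \<and> Q \<ge> 3 \<and> S \<ge> 6 \<and>
     (\<forall>q syms. q < Q \<and> q \<notin> {1, 2} \<and> length syms = K \<and> set syms \<subseteq> {0..<S} \<longrightarrow>
        (case \<delta> q syms of (q', ws, mv) \<Rightarrow>
           q' < Q \<and> length ws = K \<and> set ws \<subseteq> {0..<S} \<and>
           length mv = K \<and> set mv \<subseteq> {-1, 0, 1})))"

definition step :: "machine \<Rightarrow> config \<Rightarrow> config" where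
  "step M c = (case M of (K, Q, S, \<delta>) \<Rightarrow> case c of (q, tps, hds) \<Rightarrow>
     if q \<in> {1, 2} then c
     else (let syms = map (\<lambda>i. (tps ! i) (hds ! i)) [0..<K] in
           case \<delta> q syms of (q', ws, mv) \<Rightarrow>
             (q', map (\<lambda>i. (tps ! i)(hds ! i := ws ! i)) [0..<K],
                  map (\<lambda>i. hds ! i + mv ! i) [0..<K])))"

definition run :: "machine \<Rightarrow> config \<Rightarrow> nat \<Rightarrow> config" where
  "run M c t = (step M ^^ t) c"

definition state_of :: "config \<Rightarrow> nat" where
  "state_of c = fst c"

definition heads_of :: "config \<Rightarrow> int list" where
  "heads_of c = snd (snd c)"

definition space_used :: "machine \<Rightarrow> config \<Rightarrow> nat \<Rightarrow> nat" where
  "space_used M c t = (\<Sum>i<fst M. card {heads_of (run M c s) ! i | s. s \<le> t})"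

text \<open>Symbols: a = 1, b = 2, end-of-word marker = 3, end-of-list marker = 4, unary digit = 5.
  The input u_1 # ... u_n # $ v_1 # ... v_n # $ 1^k is written on tape 0 from cell 0 on.\<close>

definition enc_letter :: "letter \<Rightarrow> nat" where
  "enc_letter c = (case c of La \<Rightarrow> 1 | Lb \<Rightarrow> 2)"

definition enc_words :: "letter list list \<Rightarrow> nat list" where
  "enc_words ws = concat (map (\<lambda>w. map enc_letter w @ [3]) ws) @ [4]"

definition enc_input :: "letter list list \<Rightarrow> letter list list \<Rightarrow> nat \<Rightarrow> nat list" where
  "enc_input us vs k = enc_words us @ enc_words vs @ replicate k 5"

definition tape_of_list :: "nat list \<Rightarrow> int \<Rightarrow> nat" where
  "tape_of_list xs p = (if 0 \<le> p \<and> nat p < length xs then xs ! nat p else 0)"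

definition init_config :: "machine \<Rightarrow> nat list \<Rightarrow> config" where
  "init_config M xs = (0, tape_of_list xs # replicate (fst M - 1) (\<lambda>_. 0), replicate (fst M) 0)"

end

theory Submission
  imports Defs
begin

text \<open>All formulas of size at most \<open>k\<close> are enumerated as postfix codes of length \<open>k\<close> over eight
  instructions (one of them does nothing), which the machine runs through as the digits of an octal
  counter. For each code the input is read once from right to left. At every letter a stack
  machine runs through the code and computes the truth values of all subformulas at the current
  position. The operators \<open>X\<close>, \<open>F\<close> and \<open>G\<close> only refer to the next position, so one bit of
  memory for each cell of the code suffices. A formula thus costs \<open>O(k)\<close> steps per input symbol.\<close>

subsection \<open>Postfix codes of formulas\<close>

definition exec :: "nat \<Rightarrow> ltl list \<Rightarrow> ltl list" where
  "exec i fs = (if i = 2 then Atom La # fs else if i = 3 then Atom Lb # fs else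
     case fs of [] \<Rightarrow> [] | p # fs' \<Rightarrow>
       if i = 6 then Next p # fs' else if i = 7 then Fin p # fs' else if i = 8 then Glob p # fs'
       else (case fs' of [] \<Rightarrow> fs | q # gs \<Rightarrow>
         if i = 4 then And q p # gs else if i = 5 then Or q p # gs else fs))"

definition parse :: "nat list \<Rightarrow> ltl list" where
  "parse c = fold exec c []"

fun postfix :: "ltl \<Rightarrow> nat list" where
  "postfix (Atom La) = [2]"
| "postfix (Atom Lb) = [3]"
| "postfix (And p q) = postfix p @ postfix q @ [4]"
| "postfix (Or p q) = postfix p @ postfix q @ [5]"
| "postfix (Next p) = postfix p @ [6]"
| "postfix (Fin p) = postfix p @ [7]"
| "postfix (Glob p) = postfix p @ [8]"

definition codes :: "nat \<Rightarrow> nat list set" where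
  "codes k = {c. length c = k \<and> set c \<subseteq> {1..8}}"

lemma length_postfix: "length (postfix p) = fsize p"
  by (induction p rule: postfix.induct) auto

lemma set_postfix: "set (postfix p) \<subseteq> {1..8}"
  by (induction p rule: postfix.induct) auto

lemma fold_exec_postfix: "fold exec (postfix p) fs = p # fs"
  by (induction p arbitrary: fs rule: postfix.induct) (auto simp: exec_def)

lemma exec_replicate_1: "fold exec (replicate m 1) fs = fs"
  by (induction m) (auto simp: exec_def split: list.splits)

lemma ex_code:
  assumes "fsize p \<le> k"
  shows "\<exists>c\<in>codes k. parse c = [p]"
proof
  let ?c = "postfix p @ replicate (k - fsize p) 1"
  show "?c \<in> codes k"
    using assms set_postfix[of p] by (auto simp: codes_def length_postfix)
  show "parse ?c = [p]"
    using exec_replicate_1[of "k - fsize p"] by (simp add: parse_def fold_exec_postfix)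
qed

lemma exec_size: "sum_list (map fsize (exec i fs)) \<le> Suc (sum_list (map fsize fs))"
  by (auto simp: exec_def split: list.splits)

lemma fold_exec_size: "sum_list (map fsize (fold exec c fs)) \<le> length c + sum_list (map fsize fs)"
proof (induction c arbitrary: fs)
  case (Cons i c)
  show ?case using Cons[of "exec i fs"] exec_size[of i fs] by simp
qed simp

lemma parse_size: "parse c = p # fs \<Longrightarrow> fsize p \<le> length c"
  using fold_exec_size[of c "[]"] by (simp add: parse_def)

subsection \<open>Codes as octal counters\<close>

fun inc :: "nat list \<Rightarrow> nat list" where
  "inc [] = []"
| "inc (d # c) = (if d = 8 then 1 # inc c else Suc d # c)"

fun val :: "nat list \<Rightarrow> nat" where
  "val [] = 0"
| "val (d # c) = (d - 1) + 8 * val c"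

lemma inc_codes: "c \<in> codes k \<Longrightarrow> inc c \<in> codes k"
  by (induction c arbitrary: k) (auto simp: codes_def)

lemma val_inc: "set c \<subseteq> {1..8} \<Longrightarrow> \<not> set c \<subseteq> {8} \<Longrightarrow> val (inc c) = Suc (val c)"
  by (induction c) auto

lemma val_less: "set c \<subseteq> {1..8} \<Longrightarrow> val c < 8 ^ length c"
proof (induction c)
  case (Cons d c)
  then have "val c + 1 \<le> 8 ^ length c" "d \<le> 8" by auto
  then show ?case by simp
qed simp

lemma val_max: "set c \<subseteq> {8} \<Longrightarrow> Suc (val c) = 8 ^ length c"
  by (induction c) auto

lemma val_replicate_1: "val (replicate k 1) = 0"
  by (induction k) auto

lemma val_inj: "\<lbrakk>length c = length c'; set c \<subseteq> {1..8}; set c' \<subseteq> {1..8}; val c = val c'\<rbrakk> \<Longrightarrow> c = c'"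
proof (induction c c' rule: list_induct2)
  case (Cons d c d' c')
  have "d - 1 + 8 * val c = d' - 1 + 8 * val c'" "1 \<le> d" "d \<le> 8" "1 \<le> d'" "d' \<le> 8"
    using Cons.prems by auto
  then have "d + 8 * val c = d' + 8 * val c'" by linarith
  then have "val c = val c'" using \<open>1 \<le> d\<close> \<open>d \<le> 8\<close> \<open>1 \<le> d'\<close> \<open>d' \<le> 8\<close> by linarith
  moreover from this have "d = d'" using \<open>d + 8 * val c = d' + 8 * val c'\<close> by simp
  ultimately show ?case using Cons by simp
qed simp

subsection \<open>The machine\<close>

text \<open>Tape 0 is the input, tape 1 the code, tape 2 has a memory bit for each cell of the code (the
  heads of tapes 1 and 2 move together), tape 3 is the stack without its top entry, which is kept in
  the state. In the states below the first flag is the truth value expected from the current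
  words, the second one says that no letter of the current word has been read yet.\<close>

datatype st = Init | Acc | Rej | Rewind1 | Rewind0 | Incr
  | Scan bool bool "bool option" | Fetch bool bool "bool option" | Apply bool bool "bool option"
  | Back bool "bool option"

definition bit_symbol :: "bool \<Rightarrow> nat" where
  "bit_symbol b = (if b then 2 else 1)"

definition entry_symbol :: "bool option \<Rightarrow> nat" where
  "entry_symbol r = (case r of None \<Rightarrow> 0 | Some b \<Rightarrow> bit_symbol b)"

lemma bit_symbol_simps [simp]: "bit_symbol b = 2 \<longleftrightarrow> b" "bit_symbol b = 0 \<longleftrightarrow> False" "bit_symbol b = bit_symbol b' \<longleftrightarrow> b = b'"
  by (auto simp: bit_symbol_def)

lemma entry_symbol_simps [simp]: "entry_symbol None = 0" "entry_symbol (Some b) = bit_symbol b"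
  by (auto simp: entry_symbol_def)

text \<open>An entry \<^term>\<open>None\<close> marks the bottom of the stack, so that the stack head need not be
  returned between two passes. Instructions without enough operands are skipped.
  The value \<open>y\<close> stands for the next position: at the last position of a word the memory is ignored,
  and only \<open>G\<close> (digit 8) starts with the value true.\<close>

fun tr :: "st \<Rightarrow> nat \<Rightarrow> nat \<Rightarrow> nat \<Rightarrow> nat \<Rightarrow> st \<times> (nat \<times> nat \<times> nat) \<times> (int \<times> int \<times> int)" where
  "tr Init a b c d =
    (if a = 0 then (Rewind1, (b, c, d), (0, -1, 0))
     else if a = 5 then (Init, (1, c, d), (1, 1, 0))
     else (Init, (b, c, d), (1, 0, 0)))"
| "tr Acc a b c d = (Acc, (b, c, d), (0, 0, 0))"
| "tr Rej a b c d = (Rej, (b, c, d), (0, 0, 0))"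
| "tr Rewind1 a b c d =
    (if b = 0 then (Rewind0, (b, c, d), (0, 1, 0)) else (Rewind1, (b, c, d), (0, -1, 0)))"
| "tr Rewind0 a b c d =
    (if a = 0 then (Scan True True None, (b, c, d), (-1, 0, 0))
     else (Rewind0, (b, c, d), (1, 0, 0)))"
| "tr Incr a b c d =
    (if b = 0 then (Rej, (b, c, d), (0, 0, 0))
     else if b = 8 then (Incr, (1, c, d), (0, 1, 0))
     else (Rewind1, (Suc b, c, d), (0, 0, 0)))"
| "tr (Scan m f r) a b c d =
    (if a = 1 \<or> a = 2 then (Fetch m f None, (b, c, d), (0, 0, 0))
     else if a = 5 then (Scan m f r, (b, c, d), (-1, 0, 0))
     else if \<not> f \<and> r \<noteq> Some m then (Incr, (b, c, d), (1, 0, 0))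
     else if a = 0 then (Acc, (b, c, d), (0, 0, 0))
     else (Scan (if a = 4 then \<not> m else m) True r, (b, c, d), (-1, 0, 0)))"
| "tr (Fetch m f r) a b c d =
    (if b = 0 then (Back m r, (b, c, d), (0, -1, 0))
     else (Apply m f r, (b, c, d), (0, 0, if (b = 4 \<or> b = 5) \<and> r \<noteq> None then -1 else 0)))"
| "tr (Apply m f r) a b c d =
    (if b = 2 \<or> b = 3 then (Fetch m f (Some (Suc a = b)), (b, c, entry_symbol r), (0, 1, 1))
     else case r of None \<Rightarrow> (Fetch m f r, (b, c, d), (0, 1, 0))
     | Some x \<Rightarrow>
       (let y = (if f then b = 8 else c = 2) in
        if b = 4 \<or> b = 5 then
          (if d = 0 then (Fetch m f r, (b, c, d), (0, 1, 1))
           else (Fetch m f (Some (if b = 4 then d = 2 \<and> x else d = 2 \<or> x)), (b, c, d), (0, 1, 0)))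
        else if b = 6 then (Fetch m f (Some y), (b, bit_symbol x, d), (0, 1, 0))
        else if b = 7 then (Fetch m f (Some (x \<or> y)), (b, bit_symbol (x \<or> y), d), (0, 1, 0))
        else if b = 8 then (Fetch m f (Some (x \<and> y)), (b, bit_symbol (x \<and> y), d), (0, 1, 0))
        else (Fetch m f r, (b, c, d), (0, 1, 0))))"
| "tr (Back m r) a b c d =
    (if b = 0 then (Scan m False r, (b, c, d), (-1, 1, 0)) else (Back m r, (b, c, d), (0, -1, 0)))"

type_synonym aconfig =
  "st \<times> (int \<Rightarrow> nat) \<times> (int \<Rightarrow> nat) \<times> (int \<Rightarrow> nat) \<times> int \<times> int \<times> int"

definition astep :: "(int \<Rightarrow> nat) \<Rightarrow> aconfig \<Rightarrow> aconfig" where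
  "astep t0 = (\<lambda>(q, t1, t2, t3, h0, h1, h3).
     case tr q (t0 h0) (t1 h1) (t2 h1) (t3 h3) of (q', (w1, w2, w3), (m0, m1, m3)) \<Rightarrow>
       (q', t1(h1 := w1), t2(h1 := w2), t3(h3 := w3), h0 + m0, h1 + m1, h3 + m3))"

definition reaches :: "(int \<Rightarrow> nat) \<Rightarrow> nat \<Rightarrow> aconfig \<Rightarrow> aconfig \<Rightarrow> bool" where
  "reaches t0 b c c' \<longleftrightarrow> (\<exists>t\<le>b. (astep t0 ^^ t) c = c')"

lemma reaches_refl: "reaches t0 b c c"
  unfolding reaches_def by (rule exI[of _ 0]) simp

lemma reaches_step: "reaches t0 b (astep t0 c) c' \<Longrightarrow> reaches t0 (Suc b) c c'"
  unfolding reaches_def by (metis Suc_le_mono comp_apply funpow_Suc_right)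

lemma reaches_step1: "astep t0 c = c' \<Longrightarrow> reaches t0 (Suc 0) c c'"
  using reaches_step[OF reaches_refl] by blast

lemma reaches_trans:
  assumes "reaches t0 b c c'" "reaches t0 b' c' c''"
  shows "reaches t0 (b + b') c c''"
proof -
  obtain t t' where "t \<le> b" "(astep t0 ^^ t) c = c'" "t' \<le> b'" "(astep t0 ^^ t') c' = c''"
    using assms unfolding reaches_def by blast
  then have "(astep t0 ^^ (t' + t)) c = c''" "t' + t \<le> b + b'"
    by (simp_all add: funpow_add)
  then show ?thesis unfolding reaches_def by blast
qed

lemma reaches_mono: "reaches t0 b c c' \<Longrightarrow> b \<le> b' \<Longrightarrow> reaches t0 b' c c'"
  unfolding reaches_def using le_trans by blast

subsection \<open>Encoding the states by numbers\<close>

lemma finite_st: "finite (UNIV :: st set)"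
proof -
  have "(UNIV :: st set) \<subseteq> {Init, Acc, Rej, Rewind1, Rewind0, Incr}
      \<union> (\<Union>m f. range (Scan m f)) \<union> (\<Union>m f. range (Fetch m f))
      \<union> (\<Union>m f. range (Apply m f)) \<union> (\<Union>m. range (Back m))"
  proof
    fix q :: st
    show "q \<in> {Init, Acc, Rej, Rewind1, Rewind0, Incr}
      \<union> (\<Union>m f. range (Scan m f)) \<union> (\<Union>m f. range (Fetch m f))
      \<union> (\<Union>m f. range (Apply m f)) \<union> (\<Union>m. range (Back m))"
      by (cases q) (simp_all, blast+)
  qed
  then show ?thesis by (rule finite_subset) simp
qed

lemma ex_enc:
  "\<exists>(enc :: st \<Rightarrow> nat) Q. inj enc \<and> enc Init = 0 \<and> enc Acc = 1 \<and> enc Rej = 2 \<and> Q \<ge> 3 \<and> (\<forall>q. enc q < Q)"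
proof -
  obtain n and g :: "st \<Rightarrow> nat" where g: "g ` UNIV = {i. i < n}" "inj g"
    using finite_imp_inj_to_nat_seg[OF finite_st] by blast
  define enc where
    "enc q = (if q = Init then 0 else if q = Acc then 1 else if q = Rej then 2 else g q + 3)" for q
  have "inj enc" using g(2) by (auto simp: inj_def enc_def)
  moreover have "enc q < n + 3" for q using g(1) by (auto simp: enc_def)
  ultimately show ?thesis
    by (intro exI[of _ enc] exI[of _ "n + 3"]) (auto simp: enc_def)
qed

definition delta :: "(st \<Rightarrow> nat) \<Rightarrow> nat \<Rightarrow> nat list \<Rightarrow> nat \<times> nat list \<times> int list" where
  "delta enc q s = (case tr (inv enc q) (s ! 0) (s ! 1) (s ! 2) (s ! 3) of
     (q', (w1, w2, w3), (m0, m1, m3)) \<Rightarrow> (enc q', [s ! 0, w1, w2, w3], [m0, m1, m1, m3]))"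

definition mach :: "(st \<Rightarrow> nat) \<Rightarrow> nat \<Rightarrow> machine" where
  "mach enc Q = (4, Q, 9, delta enc)"

lemma tr_bounds:
  assumes "b < 9" "c < 9" "d < 9"
  shows "case tr q a b c d of (q', (w1, w2, w3), (m0, m1, m3)) \<Rightarrow>
    w1 < 9 \<and> w2 < 9 \<and> w3 < 9 \<and> {m0, m1, m3} \<subseteq> {-1, 0, 1}"
  using assms by (cases q) (simp_all add: bit_symbol_def entry_symbol_def Let_def split: option.split)

lemma wf_mach:
  assumes "Q \<ge> 3" "\<And>q. enc q < Q"
  shows "wf_machine (mach enc Q)"
proof -
  { fix q s assume s: "length (s :: nat list) = 4" "set s \<subseteq> {0..<9}"
    obtain q' w1 w2 w3 m0 m1 m3 where
      eq: "tr (inv enc q) (s ! 0) (s ! 1) (s ! 2) (s ! 3) = (q', (w1, w2, w3), (m0, m1, m3))"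
      by (metis prod_cases3)
    have lt: "s ! i < 9" if "i < 4" for i using s nth_mem[of i s] that by (metis atLeastLessThan_iff subsetD)
    have "case delta enc q s of (q', ws, mv) \<Rightarrow>
           q' < Q \<and> length ws = 4 \<and> set ws \<subseteq> {0..<9} \<and> length mv = 4 \<and> set mv \<subseteq> {-1, 0, 1}"
      using tr_bounds[OF lt[of 1] lt[of 2] lt[of 3], of "inv enc q" "s ! 0"] lt[of 0] assms(2)
      unfolding delta_def eq by simp }
  then show ?thesis using assms(1) by (auto simp: wf_machine_def mach_def)
qed

definition emb :: "(st \<Rightarrow> nat) \<Rightarrow> (int \<Rightarrow> nat) \<Rightarrow> aconfig \<Rightarrow> config" where
  "emb enc t0 = (\<lambda>(q, t1, t2, t3, h0, h1, h3). (enc q, [t0, t1, t2, t3], [h0, h1, h1, h3]))"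

lemma step_emb:
  assumes "inj enc" "enc Acc = 1" "enc Rej = 2"
  shows "step (mach enc Q) (emb enc t0 c) = emb enc t0 (astep t0 c)"
proof -
  obtain q t1 t2 t3 h0 h1 h3 where c: "c = (q, t1, t2, t3, h0, h1, h3)"
    by (metis prod_cases7)
  show ?thesis
  proof (cases "q = Acc \<or> q = Rej")
    case True
    then show ?thesis using assms by (auto simp: step_def mach_def emb_def c astep_def)
  next
    case False
    then have "enc q \<noteq> 1" "enc q \<noteq> Suc 0" "enc q \<noteq> 2" using assms by (metis injD One_nat_def)+
    moreover have "[0..<4] = [0, 1, 2, 3]" by (simp add: upt_rec)
    moreover obtain q' w1 w2 w3 m0 m1 m3 where
      eq: "tr q (t0 h0) (t1 h1) (t2 h1) (t3 h3) = (q', (w1, w2, w3), (m0, m1, m3))"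
      by (metis prod_cases3)
    ultimately show ?thesis
      by (simp add: step_def mach_def emb_def c astep_def delta_def inv_f_f[OF assms(1)] eq)
  qed
qed

lemma run_emb:
  assumes "inj enc" "enc Acc = 1" "enc Rej = 2"
  shows "run (mach enc Q) (emb enc t0 c) t = emb enc t0 ((astep t0 ^^ t) c)"
  unfolding run_def by (induction t) (simp_all add: step_emb[OF assms])

subsection \<open>One pass over the code\<close>

definition top_value :: "letter list \<Rightarrow> nat \<Rightarrow> ltl list \<Rightarrow> bool option" where
  "top_value w j fs = (case fs of [] \<Rightarrow> None | p # _ \<Rightarrow> Some (sat w j p))"

fun below :: "letter list \<Rightarrow> nat \<Rightarrow> (int \<Rightarrow> nat) \<Rightarrow> int \<Rightarrow> ltl list \<Rightarrow> bool" where
  "below w j t h [] \<longleftrightarrow> t (h - 1) = 0"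
| "below w j t h (p # ps) \<longleftrightarrow> t (h - 1) = bit_symbol (sat w j p) \<and> below w j t (h - 1) ps"

definition stack_ok :: "letter list \<Rightarrow> nat \<Rightarrow> ltl list \<Rightarrow> (int \<Rightarrow> nat) \<Rightarrow> int \<Rightarrow> bool" where
  "stack_ok w j fs t h = (case fs of [] \<Rightarrow> True | _ # ps \<Rightarrow> below w j t h ps)"

definition mem_ok :: "letter list \<Rightarrow> nat \<Rightarrow> ltl list \<Rightarrow> nat \<Rightarrow> nat \<Rightarrow> bool" where
  "mem_ok w j fs i v = (case fs of [] \<Rightarrow> True | p # _ \<Rightarrow>
     (i = 6 \<longrightarrow> v = bit_symbol (sat w j p)) \<and> (i = 7 \<longrightarrow> v = bit_symbol (sat w j (Fin p))) \<and>
     (i = 8 \<longrightarrow> v = bit_symbol (sat w j (Glob p))))"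

lemma below_upd [simp]: "h \<le> h' \<Longrightarrow> below w j (t(h' := x)) h ps = below w j t h ps"
  by (induction ps arbitrary: h) auto

lemma sat_Fin_step:
  assumes "j < length w"
  shows "sat w j (Fin p) \<longleftrightarrow> sat w j p \<or> Suc j < length w \<and> sat w (Suc j) (Fin p)"
proof -
  have "j \<le> i \<longleftrightarrow> i = j \<or> Suc j \<le> i" for i by auto
  then show ?thesis using assms le_less_trans[of "Suc j" _ "length w"]
    by (simp only: sat.simps) blast
qed

lemma sat_Glob_step:
  assumes "j < length w"
  shows "sat w j (Glob p) \<longleftrightarrow> sat w j p \<and> (Suc j < length w \<longrightarrow> sat w (Suc j) (Glob p))"
proof -
  have "j \<le> i \<longleftrightarrow> i = j \<or> Suc j \<le> i" for i by auto
  then show ?thesis using assms le_less_trans[of "Suc j" _ "length w"]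
    by (simp only: sat.simps) blast
qed

lemma instr:
  assumes "t0 h0 = enc_letter (w ! j)" "j < length w" "f \<longleftrightarrow> Suc j = length w"
    and "t1 h1 \<in> {1..8}" "\<not> f \<Longrightarrow> mem_ok w (Suc j) fs (t1 h1) (t2 h1)" "stack_ok w j fs t3 h3"
  shows "\<exists>v t3' h3'. reaches t0 2 (Fetch m f (top_value w j fs), t1, t2, t3, h0, h1, h3)
      (Fetch m f (top_value w j (exec (t1 h1) fs)), t1, t2(h1 := v), t3', h0, h1 + 1, h3') \<and>
    mem_ok w j fs (t1 h1) v \<and> stack_ok w j (exec (t1 h1) fs) t3' h3'"
proof -
  let ?c = "(Fetch m f (top_value w j fs), t1, t2, t3, h0, h1, h3)"
  have C: "case astep t0 (astep t0 ?c) of (q', t1', t2', t3', h0', h1', h3') \<Rightarrow>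
      q' = Fetch m f (top_value w j (exec (t1 h1) fs)) \<and> t1' = t1 \<and> t2' = t2(h1 := t2' h1) \<and> h0' = h0 \<and>
      h1' = h1 + 1 \<and> mem_ok w j fs (t1 h1) (t2' h1) \<and> stack_ok w j (exec (t1 h1) fs) t3' h3'"
  proof -
    have atom: "sat w j (Atom La) = (t0 h0 = 1)" "sat w j (Atom Lb) = (t0 h0 = 2)"
      using assms(1) by (cases "w ! j"; simp add: enc_letter_def)+
    have nf: "Suc j < length w \<longleftrightarrow> \<not> f" using assms(2,3) by auto
    note [simp del] = sat.simps
    have unary: "sat w j (Next p) = (\<not> f \<and> sat w (Suc j) p)"
      "sat w j (Fin p) \<longleftrightarrow> sat w j p \<or> \<not> f \<and> sat w (Suc j) (Fin p)"
      "sat w j (Glob p) \<longleftrightarrow> sat w j p \<and> (f \<or> sat w (Suc j) (Glob p))" for p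
      using sat_Fin_step[OF assms(2), of p] sat_Glob_step[OF assms(2), of p]
      by (auto simp: nf sat.simps(4))
    note defs = astep_def exec_def top_value_def mem_ok_def stack_ok_def
    consider "t1 h1 = 1" | "t1 h1 = 2" | "t1 h1 = 3" | "t1 h1 = 4" | "t1 h1 = 5" | "t1 h1 = 6"
      | "t1 h1 = 7" | "t1 h1 = 8" using assms(4) by fastforce
    then show ?thesis
    proof cases
      case 1
      then show ?thesis using assms(6) by (cases fs) (auto simp: defs fun_upd_idem_iff split: list.split)
    next
      case 2
      then show ?thesis using assms(6) by (cases fs) (simp_all add: defs fun_upd_idem_iff atom)
    next
      case 3
      then show ?thesis using assms(6) by (cases fs) (simp_all add: defs fun_upd_idem_iff atom)
    next
      case 4
      then show ?thesis using assms(6)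
        by (cases fs; cases "tl fs") (auto simp add: defs fun_upd_idem_iff Let_def sat.simps)
    next
      case 5
      then show ?thesis using assms(6)
        by (cases fs; cases "tl fs") (auto simp add: defs fun_upd_idem_iff Let_def sat.simps)
    next
      case 6
      then show ?thesis using assms(5,6)
        by (cases fs; cases f) (simp_all add: defs fun_upd_idem_iff Let_def unary)
    next
      case 7
      then show ?thesis using assms(5,6)
        by (cases fs; cases f) (simp_all add: defs fun_upd_idem_iff Let_def unary)
    next
      case 8
      then show ?thesis using assms(5,6)
        by (cases fs; cases f) (simp_all add: defs fun_upd_idem_iff Let_def unary)
    qed
  qed
  obtain q' t1' t2' t3' h0' h1' h3'
    where eq: "astep t0 (astep t0 ?c) = (q', t1', t2', t3', h0', h1', h3')"
    by (metis prod_cases7)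
  have *: "q' = Fetch m f (top_value w j (exec (t1 h1) fs)) \<and> t1' = t1 \<and>
      t2' = t2(h1 := t2' h1) \<and> h0' = h0 \<and> h1' = h1 + 1 \<and> mem_ok w j fs (t1 h1) (t2' h1) \<and>
      stack_ok w j (exec (t1 h1) fs) t3' h3'"
    using C unfolding eq prod.case .
  have "reaches t0 2 ?c (astep t0 (astep t0 ?c))"
    unfolding numeral_2_eq_2 by (intro reaches_step reaches_refl)
  also have "astep t0 (astep t0 ?c) =
      (Fetch m f (top_value w j (exec (t1 h1) fs)), t1, t2(h1 := t2' h1), t3', h0, h1 + 1, h3')"
    unfolding eq prod.inject by (intro conjI refl; use * in \<open>elim conjE\<close>)
  finally show ?thesis
    by (intro exI[of _ "t2' h1"] exI[of _ t3'] exI[of _ h3'] conjI; use * in \<open>elim conjE\<close>)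
qed

lemma tape_of_list_nth: "p < length c \<Longrightarrow> tape_of_list c (int p) = c ! p"
  by (simp add: tape_of_list_def)

lemma tape_of_list_outside: "p < 0 \<or> p \<ge> int (length c) \<Longrightarrow> tape_of_list c p = 0"
  by (auto simp: tape_of_list_def)

lemma codes_nth: "c \<in> codes k \<Longrightarrow> p < k \<Longrightarrow> c ! p \<in> {1..8}"
  unfolding codes_def using nth_mem by blast

definition mems_ok :: "letter list \<Rightarrow> nat \<Rightarrow> nat list \<Rightarrow> (int \<Rightarrow> nat) \<Rightarrow> bool" where
  "mems_ok w j c t = (\<forall>p<length c. mem_ok w j (parse (take p c)) (c ! p) (t (int p)))"

lemma pass:
  assumes c: "c \<in> codes k"
    and w: "t0 h0 = enc_letter (w ! j)" "j < length w" "f \<longleftrightarrow> Suc j = length w"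
    and mem: "\<not> f \<Longrightarrow> mems_ok w (Suc j) c t2"
    and "n \<le> k"
  shows "\<exists>t2' t3' h3'. reaches t0 (2 * n) (Fetch m f None, tape_of_list c, t2, t3, h0, 0, h3)
      (Fetch m f (top_value w j (parse (take n c))), tape_of_list c, t2', t3', h0, int n, h3') \<and>
    (\<forall>p<n. mem_ok w j (parse (take p c)) (c ! p) (t2' (int p))) \<and>
    (\<forall>p\<ge>n. t2' (int p) = t2 (int p)) \<and> stack_ok w j (parse (take n c)) t3' h3'"
  using \<open>n \<le> k\<close>
proof (induction n)
  case 0
  have "reaches t0 0 (Fetch m f None, tape_of_list c, t2, t3, h0, 0, h3)
      (Fetch m f None, tape_of_list c, t2, t3, h0, 0, h3)" by (rule reaches_refl)
  then show ?case
    by (intro exI[of _ t2] exI[of _ t3] exI[of _ h3]) (simp add: parse_def top_value_def stack_ok_def)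
next
  case (Suc n)
  let ?fs = "parse (take n c)"
  from Suc obtain t2' t3' h3' where
    r: "reaches t0 (2 * n) (Fetch m f None, tape_of_list c, t2, t3, h0, 0, h3)
      (Fetch m f (top_value w j ?fs), tape_of_list c, t2', t3', h0, int n, h3')"
    and m: "\<forall>p<n. mem_ok w j (parse (take p c)) (c ! p) (t2' (int p))"
      "\<forall>p\<ge>n. t2' (int p) = t2 (int p)"
    and s: "stack_ok w j ?fs t3' h3'"
    by auto
  have k: "length c = k" using c by (simp add: codes_def)
  have nth: "tape_of_list c (int n) = c ! n" using Suc.prems k by (simp add: tape_of_list_nth)
  have fs: "parse (take (Suc n) c) = exec (c ! n) ?fs"
    using Suc.prems k by (simp add: parse_def take_Suc_conv_app_nth)
  have "\<not> f \<Longrightarrow> mem_ok w (Suc j) ?fs (tape_of_list c (int n)) (t2' (int n))"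
    using mem m(2) Suc.prems k unfolding nth mems_ok_def by simp
  from instr[of t0 h0 w j f "tape_of_list c" "int n" ?fs t2' t3' h3' m, OF w _ this s]
  obtain v t3'' h3'' where
    r': "reaches t0 2 (Fetch m f (top_value w j ?fs), tape_of_list c, t2', t3', h0, int n, h3')
      (Fetch m f (top_value w j (exec (c ! n) ?fs)), tape_of_list c, t2'(int n := v), t3'', h0, int n + 1, h3'')"
    and v: "mem_ok w j ?fs (c ! n) v" and s': "stack_ok w j (exec (c ! n) ?fs) t3'' h3''"
    using codes_nth[OF c, of n] Suc.prems unfolding nth by auto
  have "reaches t0 (2 * Suc n) (Fetch m f None, tape_of_list c, t2, t3, h0, 0, h3)
      (Fetch m f (top_value w j (parse (take (Suc n) c))), tape_of_list c, t2'(int n := v), t3'', h0, int (Suc n), h3'')"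
    using reaches_trans[OF r r'] unfolding fs by (simp add: add.commute)
  moreover have "\<forall>p<Suc n. mem_ok w j (parse (take p c)) (c ! p) ((t2'(int n := v)) (int p))"
    using m(1) v by (auto simp: less_Suc_eq)
  moreover have "\<forall>p\<ge>Suc n. (t2'(int n := v)) (int p) = t2 (int p)"
    using m(2) by auto
  ultimately show ?case using s' unfolding fs by blast
qed

lemma back_to_start:
  assumes "c \<in> codes k" "n \<le> k"
  shows "reaches t0 (Suc n) (Back m r, tape_of_list c, t2, t3, h0, int n - 1, h3)
      (Scan m False r, tape_of_list c, t2, t3, h0 - 1, 0, h3)"
  using assms(2)
proof (induction n)
  case 0
  show ?case by (rule reaches_step1) (simp add: astep_def tape_of_list_outside fun_upd_idem_iff)
next
  case (Suc n)
  have "tape_of_list c (int n) \<noteq> 0"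
    using codes_nth[OF assms(1), of n] Suc.prems assms(1)
    by (simp add: tape_of_list_nth codes_def)
  then have "astep t0 (Back m r, tape_of_list c, t2, t3, h0, int (Suc n) - 1, h3)
      = (Back m r, tape_of_list c, t2, t3, h0, int n - 1, h3)"
    by (simp add: astep_def)
  then show ?case using Suc reaches_step by simp
qed

lemma letter:
  assumes c: "c \<in> codes k"
    and w: "t0 h0 = enc_letter (w ! j)" "j < length w" "f \<longleftrightarrow> Suc j = length w"
    and mem: "\<not> f \<Longrightarrow> mems_ok w (Suc j) c t2"
  shows "\<exists>t2' t3' h3'. reaches t0 (3 * k + 3) (Scan m f r, tape_of_list c, t2, t3, h0, 0, h3)
      (Scan m False (top_value w j (parse c)), tape_of_list c, t2', t3', h0 - 1, 0, h3') \<and>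
    mems_ok w j c t2'"
proof -
  have k: "length c = k" using c by (simp add: codes_def)
  obtain t2' t3' h3' where
    r: "reaches t0 (2 * k) (Fetch m f None, tape_of_list c, t2, t3, h0, 0, h3)
      (Fetch m f (top_value w j (parse c)), tape_of_list c, t2', t3', h0, int k, h3')"
    and m: "mems_ok w j c t2'"
    using pass[of c k t0 h0 w j f t2 k m t3 h3, OF c w mem order_refl] k
    unfolding mems_ok_def by auto
  have "t0 h0 = 1 \<or> t0 h0 = 2" using w(1) by (simp add: enc_letter_def split: letter.splits)
  then have "reaches t0 (Suc 0) (Scan m f r, tape_of_list c, t2, t3, h0, 0, h3)
      (Fetch m f None, tape_of_list c, t2, t3, h0, 0, h3)"
    by (intro reaches_step1) (simp add: astep_def)
  moreover have "reaches t0 (Suc 0) (Fetch m f (top_value w j (parse c)), tape_of_list c, t2', t3', h0, int k, h3')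
      (Back m (top_value w j (parse c)), tape_of_list c, t2', t3', h0, int k - 1, h3')"
    by (intro reaches_step1) (simp add: astep_def tape_of_list_outside fun_upd_idem_iff k)
  ultimately have "reaches t0 (Suc 0 + 2 * k + Suc 0 + Suc k)
      (Scan m f r, tape_of_list c, t2, t3, h0, 0, h3)
      (Scan m False (top_value w j (parse c)), tape_of_list c, t2', t3', h0 - 1, 0, h3')"
    by (rule reaches_trans[OF reaches_trans[OF reaches_trans[OF _ r]] back_to_start[OF c order_refl]])
  moreover have "Suc 0 + 2 * k + Suc 0 + Suc k = 3 * k + 3" by simp
  ultimately show ?thesis using m by metis
qed

subsection \<open>One scan of the input\<close>

definition verdict :: "nat list \<Rightarrow> letter list \<Rightarrow> bool option" where
  "verdict c w = top_value w 0 (parse c)"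

lemma word_suffix:
  assumes c: "c \<in> codes k"
    and w: "\<And>i. i < length w \<Longrightarrow> t0 (b + int i) = enc_letter (w ! i)"
    and "Suc n \<le> length w"
  shows "\<exists>t2' t3' h3'. reaches t0 (Suc n * (3 * k + 3))
      (Scan m True r, tape_of_list c, t2, t3, b + int (length w) - 1, 0, h3)
      (Scan m False (top_value w (length w - Suc n) (parse c)), tape_of_list c, t2', t3',
        b + int (length w - Suc n) - 1, 0, h3') \<and>
    mems_ok w (length w - Suc n) c t2'"
  using assms(3)
proof (induction n)
  case 0
  have b: "b + int (length w) - 1 = b + int (length w - Suc 0)" using 0 by linarith
  have "t0 (b + int (length w - Suc 0)) = enc_letter (w ! (length w - Suc 0))"
    using w[of "length w - Suc 0"] 0 by simp
  from letter[of c k t0 "b + int (length w - Suc 0)" w "length w - Suc 0" True t2 m r t3 h3, OF c this] 0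
  show ?case unfolding b by simp
next
  case (Suc n)
  then obtain t2' t3' h3' where
    r: "reaches t0 (Suc n * (3 * k + 3))
      (Scan m True r, tape_of_list c, t2, t3, b + int (length w) - 1, 0, h3)
      (Scan m False (top_value w (length w - Suc n) (parse c)), tape_of_list c, t2', t3',
        b + int (length w - Suc n) - 1, 0, h3')"
    and m: "mems_ok w (length w - Suc n) c t2'"
    by force
  let ?j = "length w - Suc (Suc n)"
  have j: "Suc ?j = length w - Suc n" "?j < length w" "\<not> Suc ?j = length w" using Suc.prems by auto
  have h: "b + int (length w - Suc n) - 1 = b + int ?j" using Suc.prems by linarith
  from letter[OF c, of t0 "b + int ?j" w ?j False t2' m
      "top_value w (length w - Suc n) (parse c)" t3' h3'] j m w
  obtain t2'' t3'' h3'' where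
    r': "reaches t0 (3 * k + 3)
      (Scan m False (top_value w (length w - Suc n) (parse c)), tape_of_list c, t2', t3', b + int ?j, 0, h3')
      (Scan m False (top_value w ?j (parse c)), tape_of_list c, t2'', t3'', b + int ?j - 1, 0, h3'')"
    and m': "mems_ok w ?j c t2''"
    by force
  show ?case using reaches_trans[OF r[unfolded h] r'] m' by (metis mult_Suc add.commute)
qed

lemma word:
  assumes "c \<in> codes k" "w \<noteq> []"
    and "\<And>i. i < length w \<Longrightarrow> t0 (b + int i) = enc_letter (w ! i)"
  shows "\<exists>t2' t3' h3'. reaches t0 (length w * (3 * k + 3))
      (Scan m True r, tape_of_list c, t2, t3, b + int (length w) - 1, 0, h3)
      (Scan m False (verdict c w), tape_of_list c, t2', t3', b - 1, 0, h3')"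
  using word_suffix[OF assms(1,3), of "length w - 1" m r t2 t3 h3] assms(2)
  by (auto simp: verdict_def)

definition enc_word :: "letter list \<Rightarrow> nat list" where
  "enc_word w = map enc_letter w @ [3]"

definition words_ok :: "nat list \<Rightarrow> bool \<Rightarrow> bool \<Rightarrow> bool option \<Rightarrow> letter list list \<Rightarrow> bool" where
  "words_ok c m f r ws \<longleftrightarrow> (f \<or> r = Some m) \<and> (\<forall>w\<in>set ws. verdict c w = Some m)"

lemma scan_words:
  assumes "c \<in> codes k" "\<forall>w\<in>set ws. w \<noteq> []"
    and "\<forall>i<length (concat (map enc_word ws)). t0 (b + int i) = concat (map enc_word ws) ! i"
  defines "N \<equiv> length (concat (map enc_word ws))"
  shows "\<exists>t2' t3' h3'.
    (\<exists>f' r'. reaches t0 (N * (3 * k + 3))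
      (Scan m f r, tape_of_list c, t2, t3, b + int N - 1, 0, h3)
      (Scan m f' r', tape_of_list c, t2', t3', b - 1, 0, h3') \<and> (f' \<or> r' = Some m \<longleftrightarrow> words_ok c m f r ws)) \<or>
    (\<exists>h0'. reaches t0 (N * (3 * k + 3))
      (Scan m f r, tape_of_list c, t2, t3, b + int N - 1, 0, h3)
      (Incr, tape_of_list c, t2', t3', h0', 0, h3') \<and> b \<le> h0' \<and> h0' \<le> b + int N \<and> \<not> words_ok c m f r ws)"
  using assms(2,3) unfolding N_def
proof (induction ws arbitrary: f r t2 t3 h3 rule: rev_induct)
  case Nil
  show ?case
    by (rule exI[of _ t2], rule exI[of _ t3], rule exI[of _ h3], rule disjI1, rule exI[of _ f],
        rule exI[of _ r]) (simp add: reaches_refl words_ok_def)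
next
  case (snoc w ws)
  let ?P = "3 * k + 3" and ?T = "tape_of_list c"
  let ?A = "concat (map enc_word ws)" and ?B = "concat (map enc_word (ws @ [w]))"
  define b' where "b' = b + int (length ?A)"
  have B: "?B = ?A @ map enc_letter w @ [3]" by (simp add: enc_word_def)
  have len: "length ?B = length ?A + length w + 1" by (simp add: enc_word_def)
  have A: "\<forall>i<length ?A. t0 (b + int i) = ?A ! i"
    using snoc.prems(2) unfolding B by (simp add: nth_append)
  have w: "t0 (b' + int i) = enc_letter (w ! i)" if "i < length w" for i
    using snoc.prems(2)[rule_format, of "length ?A + i"] that unfolding B b'_def
    by (simp add: nth_append add.assoc)
  have sep: "t0 (b' + int (length w)) = 3"
    using snoc.prems(2)[rule_format, of "length ?A + length w"] unfolding B b'_def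
    by (simp add: nth_append add.assoc)
  have h: "b + int (length ?B) - 1 = b' + int (length w)" unfolding len b'_def by simp
  show ?case
  proof (cases "f \<or> r = Some m")
    case False
    have "reaches t0 (Suc 0) (Scan m f r, ?T, t2, t3, b' + int (length w), 0, h3)
        (Incr, ?T, t2, t3, b' + int (length w) + 1, 0, h3)"
      using False by (intro reaches_step1) (simp add: astep_def sep)
    moreover have "Suc 0 \<le> length ?B * ?P" unfolding len by simp
    ultimately have "reaches t0 (length ?B * ?P)
        (Scan m f r, ?T, t2, t3, b' + int (length w), 0, h3)
        (Incr, ?T, t2, t3, b' + int (length w) + 1, 0, h3)"
      by (rule reaches_mono)
    moreover have "b \<le> b' + int (length w) + 1" "b' + int (length w) + 1 \<le> b + int (length ?B)"
      unfolding len b'_def by simp_all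
    ultimately show ?thesis using False unfolding h words_ok_def by blast
  next
    case True
    have r1: "reaches t0 (Suc 0) (Scan m f r, ?T, t2, t3, b' + int (length w), 0, h3)
        (Scan m True r, ?T, t2, t3, b' + int (length w) - 1, 0, h3)"
      using True by (intro reaches_step1) (auto simp add: astep_def sep)
    obtain t2' t3' h3' where
      r2: "reaches t0 (length w * ?P) (Scan m True r, ?T, t2, t3, b' + int (length w) - 1, 0, h3)
        (Scan m False (verdict c w), ?T, t2', t3', b' - 1, 0, h3')"
      using word[OF assms(1) _ w] snoc.prems(1) by fastforce
    have trans: "reaches t0 (length ?B * ?P) (Scan m f r, ?T, t2, t3, b' + int (length w), 0, h3) c'"
      if "reaches t0 (length ?A * ?P)
        (Scan m False (verdict c w), ?T, t2', t3', b + int (length ?A) - 1, 0, h3') c'" for c'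
    proof -
      have "Suc 0 + length w * ?P + length ?A * ?P \<le> length ?B * ?P"
        unfolding len by (simp add: algebra_simps)
      then show ?thesis
        using reaches_trans[OF reaches_trans[OF r1 r2[unfolded b'_def, folded b'_def]]]
          that reaches_mono unfolding b'_def by blast
    qed
    have "\<forall>w\<in>set ws. w \<noteq> []" using snoc.prems(1) by simp
    from snoc.IH[OF this A, of False "verdict c w" t2' t3' h3'] show ?thesis
    proof (elim exE disjE conjE, goal_cases)
      case (1 t2'' t3'' h3'' f' r')
      show ?case unfolding h
        by (rule exI[of _ t2''], rule exI[of _ t3''], rule exI[of _ h3''], rule disjI1,
            rule exI[of _ f'], rule exI[of _ r'])
          (use trans[OF 1(1)] 1(2) True in \<open>auto simp: words_ok_def\<close>)
    next
      case (2 t2'' t3'' h3'' h0')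
      show ?case unfolding h
        by (rule exI[of _ t2''], rule exI[of _ t3''], rule exI[of _ h3''], rule disjI2,
            rule exI[of _ h0']) (use trans[OF 2(1)] 2(2-) True len in \<open>auto simp: words_ok_def\<close>)
    qed
  qed
qed

definition good :: "nat list \<Rightarrow> letter list list \<Rightarrow> letter list list \<Rightarrow> bool" where
  "good c us vs \<longleftrightarrow>
    (\<forall>u\<in>set us. verdict c u = Some True) \<and> (\<forall>v\<in>set vs. verdict c v = Some False)"

lemma enc_words_eq: "enc_words ws = concat (map enc_word ws) @ [4]"
  by (simp add: enc_words_def enc_word_def[abs_def])

lemma set_enc_words: "set (enc_words ws) \<subseteq> {1, 2, 3, 4}"
  by (auto simp: enc_words_def enc_letter_def split: letter.splits)

lemma skip_5:
  assumes "\<forall>i<n. t0 (b + int i) = 5"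
  shows "reaches t0 n (Scan m f r, t1, t2, t3, b + int n - 1, h1, h3)
    (Scan m f r, t1, t2, t3, b - 1, h1, h3)"
  using assms
proof (induction n)
  case 0
  show ?case by (simp add: reaches_refl)
next
  case (Suc n)
  have "astep t0 (Scan m f r, t1, t2, t3, b + int (Suc n) - 1, h1, h3)
      = (Scan m f r, t1, t2, t3, b + int n - 1, h1, h3)"
    using Suc.prems by (simp add: astep_def)
  then show ?case using Suc by (intro reaches_step) simp
qed

definition decides ::
  "(int \<Rightarrow> nat) \<Rightarrow> nat list \<Rightarrow> nat \<Rightarrow> bool \<Rightarrow> nat \<Rightarrow> aconfig \<Rightarrow> bool" where
  "decides t0 c N g b cf \<longleftrightarrow>
    (if g then \<exists>cf'. reaches t0 b cf (Acc, cf')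
     else \<exists>t2 t3 h0 h3. reaches t0 b cf (Incr, tape_of_list c, t2, t3, h0, 0, h3) \<and>
       0 \<le> h0 \<and> h0 \<le> int N)"

lemma decides_trans:
  assumes "reaches t0 b cf cf'" "decides t0 c N g b' cf'"
  shows "decides t0 c N g (b + b') cf"
  using assms(2) reaches_trans[OF assms(1)] unfolding decides_def by (meson)

lemma decides_mono: "decides t0 c N g b cf \<Longrightarrow> b \<le> b' \<Longrightarrow> decides t0 c N g b' cf"
  unfolding decides_def by (meson reaches_mono)

lemma decides_scan_words:
  assumes "c \<in> codes k" "\<forall>w\<in>set ws. w \<noteq> []"
    and "\<forall>i<length (concat (map enc_word ws)). t0 (b + int i) = concat (map enc_word ws) ! i"
    and "0 \<le> b" "b + int (length (concat (map enc_word ws))) \<le> int N"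
    and "\<And>f' r' t2 t3 h3. (f' \<or> r' = Some m \<longleftrightarrow> words_ok c m f r ws) \<Longrightarrow>
      decides t0 c N g B (Scan m f' r', tape_of_list c, t2, t3, b - 1, 0, h3)"
    and "\<not> words_ok c m f r ws \<Longrightarrow> \<not> g"
  shows "decides t0 c N g (length (concat (map enc_word ws)) * (3 * k + 3) + B)
    (Scan m f r, tape_of_list c, t2, t3, b + int (length (concat (map enc_word ws))) - 1, 0, h3)"
  using scan_words[OF assms(1-3), of m f r t2 t3 h3]
proof (elim exE disjE conjE, goal_cases)
  case (1 t2' t3' h3' f' r')
  show ?case by (rule decides_trans[OF 1(1) assms(6)[OF 1(2)]])
next
  case (2 t2' t3' h3' h0')
  have "decides t0 c N g 0 (Incr, tape_of_list c, t2', t3', h0', 0, h3')"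
    using assms(4,5,7) 2(2-) reaches_refl unfolding decides_def by force
  from decides_mono[OF decides_trans[OF 2(1) this]] show ?case by simp
qed

lemma scan_input:
  assumes c: "c \<in> codes k" and ne: "\<forall>w\<in>set us \<union> set vs. w \<noteq> []"
  defines "t0 \<equiv> tape_of_list (enc_input us vs k)" and "N \<equiv> length (enc_input us vs k)"
  shows "decides t0 c N (good c us vs) ((N + 1) * (3 * k + 3))
    (Scan True True None, tape_of_list c, t2, t3, int N - 1, 0, h3)"
proof -
  let ?P = "3 * k + 3" and ?T = "tape_of_list c" and ?g = "good c us vs"
  define A V where "A = concat (map enc_word us)" and "V = concat (map enc_word vs)"
  have xs: "enc_input us vs k = A @ 4 # V @ 4 # replicate k 5"
    by (simp add: enc_input_def enc_words_eq A_def V_def)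
  have N: "N = length A + length V + 2 + k" by (simp add: N_def xs)
  have tA: "\<forall>i<length A. t0 (0 + int i) = A ! i"
    by (simp add: t0_def xs tape_of_list_nth nth_append)
  have t0: "t0 (int i) = (enc_input us vs k) ! i" if "i < N" for i
    using that unfolding t0_def N_def by (rule tape_of_list_nth)
  have t4A: "t0 (int (length A)) = 4" using t0[of "length A"] N by (simp add: xs nth_append)
  have tV: "\<forall>i<length V. t0 (int (length A) + 1 + int i) = V ! i"
  proof (intro allI impI)
    fix i assume "i < length V"
    then show "t0 (int (length A) + 1 + int i) = V ! i"
      using t0[of "length A + 1 + i"] N by (simp add: xs nth_append algebra_simps)
  qed
  have t4V: "t0 (int (length A) + 1 + int (length V)) = 4"
    using t0[of "length A + 1 + length V"] N by (simp add: xs nth_append algebra_simps)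
  have t5: "\<forall>i<k. t0 (int (length A) + int (length V) + 2 + int i) = 5"
  proof (intro allI impI)
    fix i assume "i < k"
    then show "t0 (int (length A) + int (length V) + 2 + int i) = 5"
      using t0[of "length A + length V + 2 + i"] N by (simp add: xs nth_append nth_Cons algebra_simps split: nat.split)
  qed
  have tl: "t0 (- 1) = 0" by (simp add: t0_def tape_of_list_outside)
  have g: "?g \<longleftrightarrow> words_ok c True True None us \<and> words_ok c False True None vs"
    by (auto simp: good_def words_ok_def)

  have left_end: "decides t0 c N ?g 1 (Scan True f r, ?T, t2, t3, - 1, 0, h3)"
    if "f \<or> r = Some True \<longleftrightarrow> ?g" for f r t2 t3 h3
  proof -
    have "reaches t0 1 (Scan True f r, ?T, t2, t3, - 1, 0, h3)
        (if ?g then Acc else Incr, ?T, t2, t3, if ?g then - 1 else 0, 0, h3)"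
      using that tl unfolding One_nat_def by (intro reaches_step1) (auto simp: astep_def)
    then show ?thesis unfolding decides_def by (cases ?g) (simp_all, blast, force)
  qed
  have us: "decides t0 c N ?g (length A * ?P + 1)
      (Scan True True r, ?T, t2, t3, int (length A) - 1, 0, h3)"
    if "words_ok c False True None vs" for r t2 t3 h3
  proof -
    have ok: "words_ok c True True r us = ?g" using that by (simp add: g words_ok_def)
    show ?thesis
      using decides_scan_words[of c k us t0 0 N True True r ?g 1 t2 t3 h3, OF c _ tA[unfolded A_def]]
        ne left_end unfolding ok by (simp add: A_def[symmetric] N)
  qed
  have mid: "decides t0 c N ?g (1 + (length A * ?P + 1))
      (Scan False f r, ?T, t2, t3, int (length A) + 1 - 1, 0, h3)"
    if "f \<or> r = Some False \<longleftrightarrow> words_ok c False True None vs" for f r t2 t3 h3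
  proof (cases "words_ok c False True None vs")
    case True
    then have "reaches t0 1 (Scan False f r, ?T, t2, t3, int (length A) + 1 - 1, 0, h3)
        (Scan True True r, ?T, t2, t3, int (length A) - 1, 0, h3)"
      using that t4A unfolding One_nat_def by (intro reaches_step1) (auto simp: astep_def)
    then show ?thesis using decides_trans us[OF True] by blast
  next
    case False
    then have "reaches t0 1 (Scan False f r, ?T, t2, t3, int (length A) + 1 - 1, 0, h3)
        (Incr, ?T, t2, t3, int (length A) + 1, 0, h3)"
      using that t4A unfolding One_nat_def by (intro reaches_step1) (auto simp: astep_def)
    then have "decides t0 c N ?g 1 (Scan False f r, ?T, t2, t3, int (length A) + 1 - 1, 0, h3)"
      using False unfolding decides_def g N by force
    then show ?thesis by (rule decides_mono) simp
  qed
  have vs: "decides t0 c N ?g (length V * ?P + (1 + (length A * ?P + 1)))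
      (Scan False True None, ?T, t2, t3, int (length A) + 1 + int (length V) - 1, 0, h3)" for t2 t3 h3
    unfolding V_def
    by (rule decides_scan_words[OF c]; (fold V_def)?) (use ne tV mid N in \<open>auto simp: g V_def\<close>)
  have "reaches t0 1 (Scan True True None, ?T, t2, t3, int (length A) + int (length V) + 2 - 1, 0, h3)
        (Scan False True None, ?T, t2, t3, int (length A) + 1 + int (length V) - 1, 0, h3)"
    using t4V unfolding One_nat_def by (intro reaches_step1) (simp add: astep_def algebra_simps)
  from decides_trans[OF skip_5[OF t5] decides_trans[OF this vs]]
  have "decides t0 c N ?g (k + (1 + (length V * ?P + (1 + (length A * ?P + 1)))))
      (Scan True True None, ?T, t2, t3, int (length A) + int (length V) + 2 + int k - 1, 0, h3)" .
  from decides_mono[OF this] have "decides t0 c N ?g ((N + 1) * ?P)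
      (Scan True True None, ?T, t2, t3, int (length A) + int (length V) + 2 + int k - 1, 0, h3)"
    if "k + (1 + (length V * ?P + (1 + (length A * ?P + 1)))) \<le> (N + 1) * ?P"
    using that .
  moreover have "k + (1 + (length V * ?P + (1 + (length A * ?P + 1)))) \<le> (N + 1) * ?P"
    unfolding N by (simp add: algebra_simps)
  moreover have "int (length A) + int (length V) + 2 + int k - 1 = int N - 1" by (simp add: N)
  ultimately show ?thesis by simp
qed

subsection \<open>The loop over all codes\<close>

lemma tape_of_list_upd:
  "(tape_of_list (pre @ d # c))(int (length pre) := x) = tape_of_list (pre @ x # c)"
  by (rule ext) (auto simp: tape_of_list_def nth_append nth_Cons split: nat.splits)

lemma increment:
  assumes "set c \<subseteq> {1..8}"
  shows "if set c \<subseteq> {8}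
    then \<exists>cf. reaches t0 (length c + 1)
      (Incr, tape_of_list (pre @ c), t2, t3, h0, int (length pre), h3) (Rej, cf)
    else \<exists>h1. reaches t0 (length c + 1)
      (Incr, tape_of_list (pre @ c), t2, t3, h0, int (length pre), h3)
      (Rewind1, tape_of_list (pre @ inc c), t2, t3, h0, h1, h3) \<and>
      0 \<le> h1 \<and> h1 < int (length pre + length c)"
  using assms
proof (induction c arbitrary: pre)
  case Nil
  have "reaches t0 (Suc 0) (Incr, tape_of_list pre, t2, t3, h0, int (length pre), h3)
      (Rej, tape_of_list pre, t2, t3, h0, int (length pre), h3)"
    by (rule reaches_step1) (simp add: astep_def tape_of_list_outside fun_upd_idem_iff)
  then show ?case by simp blast
next
  case (Cons d c)
  let ?cf = "(Incr, tape_of_list (pre @ d # c), t2, t3, h0, int (length pre), h3)"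
  have d: "tape_of_list (pre @ d # c) (int (length pre)) = d"
    by (simp add: tape_of_list_nth)
  show ?case
  proof (cases "d = 8")
    case True
    have "astep t0 ?cf
        = (Incr, tape_of_list ((pre @ [1]) @ c), t2, t3, h0, int (length (pre @ [1])), h3)"
      using True d by (simp add: astep_def tape_of_list_upd)
    then have "reaches t0 (length (d # c) + 1) ?cf cf'"
      if "reaches t0 (length c + 1)
        (Incr, tape_of_list ((pre @ [1]) @ c), t2, t3, h0, int (length (pre @ [1])), h3) cf'" for cf'
      using reaches_step[of t0 "length c + 1" ?cf] that by simp
    with Cons.IH[of "pre @ [1]"] Cons.prems True show ?thesis
      by (cases "set c \<subseteq> {8}") (simp_all, blast, force)
  next
    case False
    then have "astep t0 ?cf = (Rewind1, tape_of_list (pre @ Suc d # c), t2, t3, h0, int (length pre), h3)"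
      using Cons.prems d by (simp add: astep_def tape_of_list_upd)
    from reaches_mono[OF reaches_step1[OF this], of "length (d # c) + 1"] False show ?thesis
      by force
  qed
qed

lemma rewind_code:
  assumes "c \<in> codes k" "n \<le> k"
  shows "reaches t0 (Suc n) (Rewind1, tape_of_list c, t2, t3, h0, int n - 1, h3)
      (Rewind0, tape_of_list c, t2, t3, h0, 0, h3)"
  using assms(2)
proof (induction n)
  case 0
  show ?case
    by (rule reaches_step1) (simp add: astep_def tape_of_list_outside fun_upd_idem_iff)
next
  case (Suc n)
  have "tape_of_list c (int n) \<noteq> 0"
    using codes_nth[OF assms(1), of n] Suc.prems assms(1)
    by (simp add: tape_of_list_nth codes_def)
  then have "astep t0 (Rewind1, tape_of_list c, t2, t3, h0, int (Suc n) - 1, h3)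
      = (Rewind1, tape_of_list c, t2, t3, h0, int n - 1, h3)"
    by (simp add: astep_def)
  then show ?case using Suc reaches_step by simp
qed

lemma rewind_input:
  assumes "0 \<notin> set xs" "n \<le> length xs"
  shows "reaches (tape_of_list xs) (Suc n) (Rewind0, t1, t2, t3, int (length xs) - int n, h1, h3)
      (Scan True True None, t1, t2, t3, int (length xs) - 1, h1, h3)"
  using assms(2)
proof (induction n)
  case 0
  show ?case by (rule reaches_step1) (simp add: astep_def tape_of_list_outside)
next
  case (Suc n)
  have "tape_of_list xs (int (length xs - Suc n)) \<noteq> 0"
    using assms(1) Suc.prems
    by (metis Suc_le_lessD diff_less nth_mem tape_of_list_nth zero_less_Suc length_pos_if_in_set less_le_trans)
  moreover have "int (length xs - Suc n) = int (length xs) - int (Suc n)" using Suc.prems by simp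
  ultimately have "astep (tape_of_list xs) (Rewind0, t1, t2, t3, int (length xs) - int (Suc n), h1, h3)
      = (Rewind0, t1, t2, t3, int (length xs) - int n, h1, h3)"
    by (simp add: astep_def)
  then show ?case using Suc reaches_step by simp
qed

lemma enc_input_nonzero: "0 \<notin> set (enc_input us vs k)"
  using set_enc_words[of us] set_enc_words[of vs] by (auto simp: enc_input_def)

lemma code_loop:
  fixes us vs k
  defines "t0 \<equiv> tape_of_list (enc_input us vs k)" and "N \<equiv> length (enc_input us vs k)"
  defines "B \<equiv> 2 * (k + 1) + (N + 1) * (3 * k + 4)"
  assumes ne: "\<forall>w\<in>set us \<union> set vs. w \<noteq> []"
    and "c \<in> codes k" "-1 \<le> h1" "h1 < int k" "0 \<le> h0" "h0 \<le> int N"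
  shows "\<exists>q cf. reaches t0 ((8 ^ k - val c) * B) (Rewind1, tape_of_list c, t2, t3, h0, h1, h3) (q, cf) \<and>
    q \<in> {Acc, Rej} \<and> (q = Acc \<longleftrightarrow> (\<exists>c'\<in>codes k. val c \<le> val c' \<and> good c' us vs))"
  using assms(5-)
proof (induction "8 ^ k - val c" arbitrary: c t2 t3 h0 h1 h3 rule: less_induct)
  case less
  let ?cf = "(Rewind1, tape_of_list c, t2, t3, h0, h1, h3)"
  have c: "length c = k" "set c \<subseteq> {1..8}" using less.prems(1) by (auto simp: codes_def)
  have lt: "val c < 8 ^ k" using val_less[OF c(2)] c(1) by simp
  define b where "b = (k + 1) + ((N + 1) + (N + 1) * (3 * k + 3))"
  have B: "B = b + (k + 1)" by (simp add: B_def b_def algebra_simps)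
  have "reaches t0 (k + 1) ?cf (Rewind0, tape_of_list c, t2, t3, h0, 0, h3)"
    using reaches_mono[OF rewind_code[OF less.prems(1), of "nat (h1 + 1)" t0 t2 t3 h0 h3], of "k + 1"]
      less.prems(2,3) by simp
  moreover have "reaches t0 (N + 1) (Rewind0, tape_of_list c, t2, t3, h0, 0, h3)
      (Scan True True None, tape_of_list c, t2, t3, int N - 1, 0, h3)"
    using reaches_mono[OF rewind_input[OF enc_input_nonzero,
        of "nat (int N - h0)" us vs k "tape_of_list c" t2 t3 0 h3], of "N + 1"]
      less.prems(4,5) unfolding t0_def N_def by simp
  ultimately have dec: "decides t0 c N (good c us vs) b ?cf"
    unfolding b_def
    using decides_trans[OF _ decides_trans[OF _ scan_input[OF less.prems(1) ne]]]
    unfolding t0_def N_def by blast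
  show ?case
  proof (cases "good c us vs")
    case True
    then obtain cf where "reaches t0 b ?cf (Acc, cf)" using dec unfolding decides_def by auto
    moreover have "b \<le> (8 ^ k - val c) * B"
    proof -
      have "1 * B \<le> (8 ^ k - val c) * B" using lt by (intro mult_right_mono) auto
      then show ?thesis using B by simp
    qed
    ultimately show ?thesis using True less.prems(1) reaches_mono by blast
  next
    case False
    then obtain t2' t3' h0' h3' where
      r: "reaches t0 b ?cf (Incr, tape_of_list c, t2', t3', h0', 0, h3')" and h0': "0 \<le> h0'" "h0' \<le> int N"
      using dec unfolding decides_def by auto
    have larger: "val c < val c'" if "c' \<in> codes k" "val c \<le> val c'" "good c' us vs" for c'
      using that False c val_inj[of c c'] by (cases "val c = val c'") (auto simp: codes_def)
    show ?thesis
    proof (cases "set c \<subseteq> {8}")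
      case True
      then obtain cf where r': "reaches t0 (k + 1) (Incr, tape_of_list c, t2', t3', h0', 0, h3') (Rej, cf)"
        using increment[OF c(2), of t0 "[]" t2' t3' h0' h3'] c(1) by auto
      have "Suc (val c) = 8 ^ k" using val_max[OF True] c(1) by simp
      then have "8 ^ k - val c = 1" by simp
      then have "reaches t0 ((8 ^ k - val c) * B) ?cf (Rej, cf)"
        using reaches_trans[OF r r'] unfolding B by simp
      moreover have "\<not> (\<exists>c'\<in>codes k. val c \<le> val c' \<and> good c' us vs)"
      proof
        assume "\<exists>c'\<in>codes k. val c \<le> val c' \<and> good c' us vs"
        then obtain c' where "c' \<in> codes k" "val c < val c'" using larger by blast
        then show False using val_less[of c'] \<open>Suc (val c) = 8 ^ k\<close> by (auto simp: codes_def)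
      qed
      ultimately show ?thesis by blast
    next
      case False
      then obtain h1' where
        r': "reaches t0 (k + 1) (Incr, tape_of_list c, t2', t3', h0', 0, h3')
          (Rewind1, tape_of_list (inc c), t2', t3', h0', h1', h3')"
        and h1': "0 \<le> h1'" "h1' < int k"
        using increment[OF c(2), of t0 "[]" t2' t3' h0' h3'] c(1) by auto
      have v: "val (inc c) = Suc (val c)" using val_inc[OF c(2) False] .
      have "8 ^ k - val (inc c) < 8 ^ k - val c" using v lt by simp
      moreover have "- 1 \<le> h1'" using h1' by simp
      ultimately
      obtain q cf where
        r'': "reaches t0 ((8 ^ k - val (inc c)) * B)
          (Rewind1, tape_of_list (inc c), t2', t3', h0', h1', h3') (q, cf)"
        and q: "q \<in> {Acc, Rej}"
          "q = Acc \<longleftrightarrow> (\<exists>c'\<in>codes k. val (inc c) \<le> val c' \<and> good c' us vs)"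
        using less.hyps[OF _ inc_codes[OF less.prems(1)] _ h1'(2) h0', of t2' t3' h3'] by blast
      have "8 ^ k - val c = Suc (8 ^ k - val (inc c))" using v lt by simp
      then have "reaches t0 ((8 ^ k - val c) * B) ?cf (q, cf)"
        using reaches_trans[OF reaches_trans[OF r r'] r''] unfolding B by (simp add: algebra_simps)
      moreover have "(\<exists>c'\<in>codes k. val (inc c) \<le> val c' \<and> good c' us vs) \<longleftrightarrow>
          (\<exists>c'\<in>codes k. val c \<le> val c' \<and> good c' us vs)"
        unfolding v Suc_le_eq using larger less_imp_le by blast
      ultimately show ?thesis using q by blast
    qed
  qed
qed

lemma initialise:
  fixes us vs k
  defines "t0 \<equiv> tape_of_list (enc_input us vs k)" and "N \<equiv> length (enc_input us vs k)"
  shows "reaches t0 (N + 1) (Init, tape_of_list [], t2, t3, 0, 0, h3)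
    (Rewind1, tape_of_list (replicate k 1), t2, t3, int N, int k - 1, h3)"
proof -
  let ?ys = "enc_words us @ enc_words vs"
  let ?M = "length ?ys"
  have xs: "enc_input us vs k = ?ys @ replicate k 5" by (simp add: enc_input_def)
  have N: "N = ?M + k" unfolding N_def xs by simp
  have t0: "t0 (int i) = (?ys @ replicate k 5) ! i" if "i < N" for i
    using that unfolding t0_def N_def xs by (rule tape_of_list_nth)
  have "reaches t0 n (Init, tape_of_list [], t2, t3, 0, 0, h3) (Init, tape_of_list [], t2, t3, int n, 0, h3)"
    if "n \<le> ?M" for n
    using that
  proof (induction n)
    case 0
    show ?case by (simp add: reaches_refl)
  next
    case (Suc n)
    have "?ys ! n \<in> set ?ys" using Suc.prems by (intro nth_mem) simp
    then have "t0 (int n) \<noteq> 0" "t0 (int n) \<noteq> 5"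
      using Suc.prems t0[of n] N set_enc_words[of us] set_enc_words[of vs] nth_append[of ?ys "replicate k 5" n]
      by auto
    then have "reaches t0 (Suc 0) (Init, tape_of_list [], t2, t3, int n, 0, h3)
        (Init, tape_of_list [], t2, t3, int (Suc n), 0, h3)"
      by (intro reaches_step1) (simp add: astep_def)
    then show ?case using reaches_trans[OF Suc.IH] Suc.prems by fastforce
  qed
  from this[of ?M] have
    r1: "reaches t0 ?M (Init, tape_of_list [], t2, t3, 0, 0, h3) (Init, tape_of_list [], t2, t3, int ?M, 0, h3)"
    by simp
  have "reaches t0 n (Init, tape_of_list [], t2, t3, int ?M, 0, h3)
      (Init, tape_of_list (replicate n 1), t2, t3, int ?M + int n, int n, h3)" if "n \<le> k" for n
    using that
  proof (induction n)
    case 0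
    show ?case by (simp add: reaches_refl)
  next
    case (Suc n)
    have "t0 (int ?M + int n) = 5"
      using t0[of "?M + n"] Suc.prems unfolding N by (simp add: nth_append)
    moreover have "(tape_of_list (replicate n 1))(int n := 1) = tape_of_list (replicate (Suc n) 1)"
      by (rule ext) (auto simp: tape_of_list_def nth_append nth_Cons less_Suc_eq simp del: replicate_Suc)
    ultimately have "reaches t0 (Suc 0)
        (Init, tape_of_list (replicate n 1), t2, t3, int ?M + int n, int n, h3)
        (Init, tape_of_list (replicate (Suc n) 1), t2, t3, int ?M + int (Suc n), int (Suc n), h3)"
      by (intro reaches_step1) (simp add: astep_def)
    then show ?case using reaches_trans[OF Suc.IH] Suc.prems by fastforce
  qed
  from reaches_trans[OF r1 this[of k]]
  have r2: "reaches t0 N (Init, tape_of_list [], t2, t3, 0, 0, h3)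
      (Init, tape_of_list (replicate k 1), t2, t3, int N, int k, h3)"
    unfolding N by simp
  have "reaches t0 (Suc 0) (Init, tape_of_list (replicate k 1), t2, t3, int N, int k, h3)
      (Rewind1, tape_of_list (replicate k 1), t2, t3, int N, int k - 1, h3)"
    by (intro reaches_step1) (simp add: astep_def t0_def N_def tape_of_list_outside)
  from reaches_trans[OF r2 this] show ?thesis by simp
qed

lemma ex_good_iff:
  assumes "us \<noteq> []"
  shows "(\<exists>c\<in>codes k. good c us vs) \<longleftrightarrow> (\<exists>\<phi>. fsize \<phi> \<le> k \<and> separates \<phi> us vs)"
proof
  assume "\<exists>c\<in>codes k. good c us vs"
  then obtain c where c: "c \<in> codes k" "good c us vs" by blast
  obtain u where "u \<in> set us" using assms by (cases us) auto
  then have "verdict c u = Some True" using c(2) by (simp add: good_def)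
  then obtain \<phi> fs where p: "parse c = \<phi> # fs"
    by (auto simp: verdict_def top_value_def split: list.splits)
  then have "separates \<phi> us vs" using c(2)
    by (simp add: separates_def models_def good_def verdict_def top_value_def)
  moreover have "fsize \<phi> \<le> k" using parse_size[OF p] c(1) by (simp add: codes_def)
  ultimately show "\<exists>\<phi>. fsize \<phi> \<le> k \<and> separates \<phi> us vs" by blast
next
  assume "\<exists>\<phi>. fsize \<phi> \<le> k \<and> separates \<phi> us vs"
  then obtain \<phi> where p: "fsize \<phi> \<le> k" "separates \<phi> us vs" by blast
  obtain c where "c \<in> codes k" "parse c = [\<phi>]" using ex_code[OF p(1)] by blast
  moreover from this have "good c us vs" using p(2)
    by (simp add: separates_def models_def good_def verdict_def top_value_def)
  ultimately show "\<exists>c\<in>codes k. good c us vs" by blast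
qed

lemma machine_correct:
  fixes us vs k
  defines "t0 \<equiv> tape_of_list (enc_input us vs k)" and "N \<equiv> length (enc_input us vs k)"
  assumes "\<forall>w\<in>set us \<union> set vs. w \<noteq> []" "us \<noteq> []"
  shows "\<exists>q cf. reaches t0 (N + 1 + 8 ^ k * (2 * (k + 1) + (N + 1) * (3 * k + 4)))
      (Init, \<lambda>_. 0, t2, t3, 0, 0, h3) (q, cf) \<and>
    q \<in> {Acc, Rej} \<and> (q = Acc \<longleftrightarrow> (\<exists>\<phi>. fsize \<phi> \<le> k \<and> separates \<phi> us vs))"
proof -
  have "replicate k 1 \<in> codes k" by (auto simp: codes_def)
  moreover have "- 1 \<le> int k - 1" "int k - 1 < int k" "0 \<le> int N" "int N \<le> int N" by simp_all
  ultimately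
  obtain q cf where
    r: "reaches t0 (8 ^ k * (2 * (k + 1) + (N + 1) * (3 * k + 4)))
      (Rewind1, tape_of_list (replicate k 1), t2, t3, int N, int k - 1, h3) (q, cf)"
    and q: "q \<in> {Acc, Rej}" "q = Acc \<longleftrightarrow> (\<exists>c'\<in>codes k. 0 \<le> val c' \<and> good c' us vs)"
    using code_loop[OF assms(3), of "replicate k 1" k "int k - 1" "int N" t2 t3 h3]
    unfolding t0_def N_def val_replicate_1 diff_zero by blast
  have "(\<lambda>_. 0) = tape_of_list []" by (simp add: tape_of_list_def fun_eq_iff)
  then have "reaches t0 (N + 1 + 8 ^ k * (2 * (k + 1) + (N + 1) * (3 * k + 4)))
      (Init, \<lambda>_. 0, t2, t3, 0, 0, h3) (q, cf)"
    using reaches_trans[OF _ r] initialise[of us vs k t2 t3 h3] unfolding t0_def N_def by metis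
  moreover have "q = Acc \<longleftrightarrow> (\<exists>\<phi>. fsize \<phi> \<le> k \<and> separates \<phi> us vs)"
    using q(2) ex_good_iff[OF assms(4), of k vs] by simp
  ultimately show ?thesis using q(1) by blast
qed

subsection \<open>Time and space\<close>

lemma funpow_halted:
  assumes "(astep t0 ^^ t) c = (q, cf)" "q \<in> {Acc, Rej}" "t \<le> T"
  shows "(astep t0 ^^ T) c = (q, cf)"
  using assms(3)
proof (induction T rule: dec_induct)
  case (step n)
  obtain t1 t2 t3 h0 h1 h3 where "cf = (t1, t2, t3, h0, h1, h3)" by (metis prod_cases6)
  then have "astep t0 (q, cf) = (q, cf)" using assms(2) by (auto simp: astep_def)
  then show ?case using step by simp
qed (use assms(1) in simp)

lemma space_used_le:
  assumes "\<And>s. t \<le> s \<Longrightarrow> s \<le> T \<Longrightarrow> run M c s = run M c t"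
  shows "space_used M c T \<le> fst M * (t + 1)"
proof -
  have "card {heads_of (run M c s) ! i | s. s \<le> T} \<le> t + 1" for i
  proof -
    have "{heads_of (run M c s) ! i | s. s \<le> T} \<subseteq> (\<lambda>s. heads_of (run M c s) ! i) ` {..t}"
    proof
      fix x assume "x \<in> {heads_of (run M c s) ! i | s. s \<le> T}"
      then obtain s where s: "x = heads_of (run M c s) ! i" "s \<le> T" by blast
      then have "x = heads_of (run M c (min s t)) ! i"
        using assms[of s] by (cases "t \<le> s") (simp_all add: min_def)
      then show "x \<in> (\<lambda>s. heads_of (run M c s) ! i) ` {..t}" by simp
    qed
    then have "card {heads_of (run M c s) ! i | s. s \<le> T} \<le> card {..t}"
      by (rule surj_card_le[rotated]) simp
    then show ?thesis by simp
  qed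
  then show ?thesis
    unfolding space_used_def
    using sum_bounded_above[of "{..<fst M}" "\<lambda>i. card {heads_of (run M c s) ! i | s. s \<le> T}" "t + 1"]
    by simp
qed

lemma length_concat_enc_word:
  "\<forall>w\<in>set ws. length w \<le> L \<Longrightarrow> length (concat (map enc_word ws)) \<le> length ws * (L + 1)"
  by (induction ws) (auto simp: enc_word_def)

lemma time_bound:
  fixes n L k N :: nat
  assumes "N \<le> 2 * (n * (L + 1)) + 2 + k" "n \<ge> 1" "L \<ge> 1"
  shows "4 * (N + 1 + 8 ^ k * (2 * (k + 1) + (N + 1) * (3 * k + 4)) + 1)
    \<le> 152 * 2 ^ (152 * k) * n * L"
proof -
  define D K where "D = n * L" and "K = k + 1"
  have D: "D \<ge> 1" "n \<le> D" using assms(2,3) by (simp_all add: D_def)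
  have K: "K \<ge> 1" "K \<le> 2 ^ k" using less_exp[of k] by (simp_all add: K_def Suc_leI)
  have DK: "D \<le> D * K" "K \<le> D * K" using D K by simp_all
  have "n * (L + 1) = D + n" by (simp add: D_def)
  then have "N + 1 \<le> 6 * D + K" using assms(1) D unfolding K_def by linarith
  also have "\<dots> \<le> 7 * (D * K)" using DK by linarith
  finally have N: "N + 1 \<le> 7 * (D * K)" .
  have DKK: "D * K \<le> D * K * K" "K \<le> D * K * K" using D K by simp_all
  have "2 * (k + 1) + (N + 1) * (3 * k + 4) \<le> 2 * K + 7 * (D * K) * (4 * K)"
    using mult_mono[OF N, of "3 * k + 4" "4 * K"] by (simp add: K_def)
  also have "\<dots> \<le> 30 * (D * K * K)" using DKK by simp
  finally have B: "2 * (k + 1) + (N + 1) * (3 * k + 4) \<le> 30 * (D * K * K)" .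
  have E: "D * K * K \<le> 8 ^ k * (D * K * K)" by simp
  have N': "N + 1 \<le> 7 * (8 ^ k * (D * K * K))" using N DKK(1) E by linarith
  have "1 \<le> D * K * K" using D K by simp
  then have "N + 1 + 8 ^ k * (2 * (k + 1) + (N + 1) * (3 * k + 4)) + 1
      \<le> 7 * (8 ^ k * (D * K * K)) + 8 ^ k * (30 * (D * K * K)) + 8 ^ k * (D * K * K)"
    using N' by (intro add_mono mult_left_mono B) simp_all
  also have "\<dots> = 38 * (D * (8 ^ k * (K * K)))" by (simp add: algebra_simps)
  also have "8 ^ k * (K * K) \<le> 8 ^ k * (2 ^ k * 2 ^ k)" using K by (intro mult_left_mono mult_mono) auto
  also have "8 ^ k * (2 ^ k * 2 ^ k) = (2 :: nat) ^ (5 * k)"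
    by (simp add: power_mult power_mult_distrib[symmetric])
  also have "(2 :: nat) ^ (5 * k) \<le> 2 ^ (152 * k)" by (intro power_increasing) auto
  finally show ?thesis by (simp add: D_def algebra_simps)
qed

theorem theorem1:
  shows "\<exists>M C. wf_machine M \<and>
    (\<forall>n L k us vs.
       length us = n \<and> length vs = n \<and> n \<ge> 1 \<and>
       (\<forall>w\<in>set us \<union> set vs. w \<noteq> [] \<and> length w \<le> L) \<longrightarrow>
       (let c0 = init_config M (enc_input us vs k);
            T = C * 2 ^ (C * k) * n * L
        in state_of (run M c0 T) \<in> {1, 2} \<and>
           (state_of (run M c0 T) = 1 \<longleftrightarrow>
              (\<exists>\<phi>. fsize \<phi> \<le> k \<and> separates \<phi> us vs)) \<and>
           space_used M c0 T \<le> T))"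
proof -
  obtain enc :: "st \<Rightarrow> nat" and Q where enc: "inj enc" "enc Init = 0" "enc Acc = 1" "enc Rej = 2" "Q \<ge> 3" "\<And>q. enc q < Q"
    using ex_enc by blast
  define M where "M = mach enc Q"
  have wf: "wf_machine M" unfolding M_def using wf_mach enc(5,6) by blast
  have main: "state_of (run M c0 T) \<in> {1, 2} \<and>
      (state_of (run M c0 T) = 1 \<longleftrightarrow> (\<exists>\<phi>. fsize \<phi> \<le> k \<and> separates \<phi> us vs)) \<and>
      space_used M c0 T \<le> T"
    if len: "length us = n" "length vs = n" "n \<ge> 1"
      and ws: "\<forall>w\<in>set us \<union> set vs. w \<noteq> [] \<and> length w \<le> L"
      and c0: "c0 = init_config M (enc_input us vs k)" and T: "T = 152 * 2 ^ (152 * k) * n * L"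
    for n L k us vs c0 T
  proof -
    let ?t0 = "tape_of_list (enc_input us vs k)" and ?N = "length (enc_input us vs k)"
    let ?c = "(Init, \<lambda>_. 0, \<lambda>_. 0, \<lambda>_. 0, 0, 0, 0) :: aconfig"
    have us: "us \<noteq> []" using len by auto
    then have "hd us \<noteq> []" "length (hd us) \<le> L" using ws by simp_all
    then have L: "L \<ge> 1" by (cases "hd us") auto
    have init: "c0 = emb enc ?t0 ?c"
      using enc(2) by (simp add: c0 init_config_def M_def mach_def emb_def numeral_eq_Suc)
    note run = run_emb[OF enc(1,3,4), of Q, folded M_def]
    obtain q cf t where t: "t \<le> ?N + 1 + 8 ^ k * (2 * (k + 1) + (?N + 1) * (3 * k + 4))"
      and halt: "(astep ?t0 ^^ t) ?c = (q, cf)" "q \<in> {Acc, Rej}"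
      and q: "q = Acc \<longleftrightarrow> (\<exists>\<phi>. fsize \<phi> \<le> k \<and> separates \<phi> us vs)"
      using machine_correct[of us vs k "\<lambda>_. 0" "\<lambda>_. 0" 0] ws us unfolding reaches_def by blast
    have "?N \<le> 2 * (n * (L + 1)) + 2 + k"
      using length_concat_enc_word[of us L] length_concat_enc_word[of vs L] ws len
      by (simp add: enc_input_def enc_words_eq)
    from order_trans[OF mult_le_mono2[OF add_le_mono1[OF t]] time_bound[OF this len(3) L]]
    have tT: "4 * (t + 1) \<le> T" unfolding T .
    have final: "run M c0 s = emb enc ?t0 (q, cf)" if "t \<le> s" for s
      unfolding init run using funpow_halted[OF halt that] by simp
    have "state_of (run M c0 T) = enc q"
      using final[of T] tT by (simp add: state_of_def emb_def split: prod.splits)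
    moreover have "space_used M c0 T \<le> fst M * (t + 1)"
      by (rule space_used_le) (simp add: final)
    moreover have "fst M = 4" by (simp add: M_def mach_def)
    ultimately show ?thesis using tT halt(2) q enc(3,4) by auto
  qed
  show ?thesis
    unfolding Let_def
    by (rule exI[of _ M], rule exI[of _ 152], rule conjI[OF wf], intro allI impI, elim conjE)
      (rule main[OF _ _ _ _ refl refl]; assumption)
qed

end
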